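(* Let $\Lambda$ be a finite set with more than one element, $X=\Lambda^{\mathbb{Z}}$, $\sigma$ the shift on $X$, and $\mu=\prod_{\mathbb{Z}}\mu_1$, where $\mu_1$ is a probability measure on $\Lambda$ with $\mu_1(\{\lambda\})>0$ for all $\lambda\in\Lambda$. Let $n>1$ be an integer. Let $C_1,C_1'$ be non-empty proper subsets of $\Lambda$, and let $C=\{x\in X: x_0\in C_1\}$, $C'=\{x\in X: x_0\in C_1'\}$, $D=X\setminus C$, $D'=X\setminus C'$, with $C\neq C'$. Define $W=\chi_C\otimes u^*+\chi_D\otimes v^*$ and $W'=\chi_{C'}\otimes u^*+\chi_{D'}\otimes v^*$ in $L^\infty(X,\mu)\otimes M_n$. Then $WV$ is unitarily equivalent to $W'V$ if and only if $n=2$ and $C=D'$ and $D=C'$.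
   Context: $\sigma$ is the shift to the right, $\sigma(x)_i=x_{i-1}$. $V$ is the unitary on $L^2(X,\mu)$ given by $(V\xi)(x)=\xi(\sigma^{-1}(x))$, and $V$ also denotes $V\otimes1$ on $L^2(X,\mu)\otimes\mathbb{C}^n$. $M_n$ is the algebra of complex $n\times n$ matrices, $\omega=e^{2\pi i/n}$, $u=\mathrm{diag}(1,\omega,\dots,\omega^{n-1})$, and $v\in M_n$ is the cyclic shift permutation unitary with $vuv^*=\omega u$. $\chi_S$ is the characteristic function of $S$. "$WV$ is unitarily equivalent to $W'V$" means that there is a unitary $\zeta\in L^\infty(X,\mu)\otimes M_n$ with $WV=\zeta W'V\zeta^*$, i.e. $W(x)=\zeta(x)W'(x)\zeta(\sigma^{-1}(x))^*$ for almost every $x$. *)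

theory Defs
  imports
    "HOL-Probability.Probability"
    "Jordan_Normal_Form.Schur_Decomposition"
begin

section \<open>The two-sided Bernoulli shift\<close>

text \<open>The alphabet is \<open>space m\<close>; the space of the product measure is the set of all
  \<open>x :: int \<Rightarrow> 'a\<close> with \<open>x i \<in> space m\<close> for every \<open>i\<close>.\<close>

definition bernoulli_measure :: "'a measure \<Rightarrow> (int \<Rightarrow> 'a) measure" where
  "bernoulli_measure m = (\<Pi>\<^sub>M i\<in>(UNIV :: int set). m)"

definition right_shift :: "(int \<Rightarrow> 'a) \<Rightarrow> int \<Rightarrow> 'a" where
  "right_shift x = (\<lambda>i. x (i - 1))"

lemma inv_right_shift: "inv_into UNIV right_shift x = (\<lambda>i. x (i + 1))"
proof (rule inv_f_eq)
  show "inj right_shift"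
    by (rule inj_on_inverseI[where g = "\<lambda>x i. x (i + 1)"]) (simp add: right_shift_def)
  show "right_shift (\<lambda>i. x (i + 1)) = x"
    by (simp add: right_shift_def)
qed

definition cylinder0 :: "'a set \<Rightarrow> 'a set \<Rightarrow> (int \<Rightarrow> 'a) set" where
  "cylinder0 \<Lambda> S = {x. (\<forall>i. x i \<in> \<Lambda>) \<and> x 0 \<in> S}"


section \<open>The matrices \<open>u\<close> and \<open>v\<close>\<close>

definition root_of_unity :: "nat \<Rightarrow> complex" where
  "root_of_unity n = exp (2 * of_real pi * \<i> / of_nat n)"

definition clock_mat :: "nat \<Rightarrow> complex mat" where
  "clock_mat n = mat_diag n (\<lambda>i. root_of_unity n ^ i)"

text \<open>Of the two cyclic shifts, this is the one sending \<open>e\<^sub>k\<close> to \<open>e\<^sub>k\<^sub>-\<^sub>1\<close>; the direction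
  is dictated by the relation \<open>v u v\<^sup>* = \<omega> u\<close>, proved below.\<close>

definition shift_mat :: "nat \<Rightarrow> complex mat" where
  "shift_mat n = Matrix.mat n n (\<lambda>(i, j). if j = (i + 1) mod n then 1 else 0)"

lemma mat_adjoint_square:
  fixes A :: "complex mat"
  assumes "A \<in> carrier_mat n n"
  shows "mat_adjoint A = Matrix.mat n n (\<lambda>(i, j). cnj (A $$ (j, i)))"
  using assms unfolding mat_adjoint_def by (intro eq_matI) (auto simp: mat_of_rows_def)

definition unitary_mat :: "nat \<Rightarrow> complex mat \<Rightarrow> bool" where
  "unitary_mat n A \<longleftrightarrow> A \<in> carrier_mat n n
     \<and> A * mat_adjoint A = 1\<^sub>m n \<and> mat_adjoint A * A = 1\<^sub>m n"

lemma shift_clock_relation: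
  assumes "n > 0"
  shows "shift_mat n * clock_mat n * mat_adjoint (shift_mat n)
    = root_of_unity n \<cdot>\<^sub>m clock_mat n"
proof (rule eq_matI)
  let ?w = "root_of_unity n"
  have w1: "?w ^ n = 1"
    using assms unfolding root_of_unity_def by (simp flip: exp_of_nat_mult)
  have c: "shift_mat n \<in> carrier_mat n n" by (simp add: shift_mat_def)
  fix i j assume "i < dim_row (?w \<cdot>\<^sub>m clock_mat n)" "j < dim_col (?w \<cdot>\<^sub>m clock_mat n)"
  then have ij: "i < n" "j < n" by (auto simp: clock_mat_def mat_diag_def)
  have inj: "(i + 1) mod n = (j + 1) mod n \<longleftrightarrow> i = j"
    using ij by (auto simp: mod_Suc split: if_splits)
  have pow: "?w ^ ((i + 1) mod n) = ?w * ?w ^ i"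
    using ij w1 by (cases "i + 1 = n") (auto simp flip: power_Suc)
  have m: "(i + 1) mod n < n" using assms by simp
  have "shift_mat n * clock_mat n
      = Matrix.mat n n (\<lambda>(i, j). shift_mat n $$ (i, j) * ?w ^ j)"
    unfolding clock_mat_def by (rule mat_diag_mult_right[OF c])
  then have sc: "shift_mat n * clock_mat n
      = Matrix.mat n n (\<lambda>(i, j). if j = (i + 1) mod n then ?w ^ j else 0)"
    by (auto simp: shift_mat_def intro!: eq_matI)
  have adj: "mat_adjoint (shift_mat n)
      = Matrix.mat n n (\<lambda>(i, j). if i = (j + 1) mod n then 1 else 0)"
    unfolding mat_adjoint_square[OF c] by (auto simp: shift_mat_def intro!: eq_matI)
  have "(shift_mat n * clock_mat n * mat_adjoint (shift_mat n)) $$ (i, j)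
    = (\<Sum>k = 0..<n. (if k = (i + 1) mod n then ?w ^ k else 0) * (if k = (j + 1) mod n then 1 else 0))"
    unfolding sc adj using ij by (simp add: scalar_prod_def)
  also have "\<dots> = (\<Sum>k = 0..<n. if k = (i + 1) mod n then (if i = j then ?w ^ k else 0) else 0)"
    using inj by (intro sum.cong) auto
  also have "\<dots> = (if i = j then ?w ^ ((i + 1) mod n) else 0)"
    using m by (simp add: sum.delta)
  also have "\<dots> = (?w \<cdot>\<^sub>m clock_mat n) $$ (i, j)"
    using ij pow by (auto simp: clock_mat_def mat_diag_def)
  finally show "(shift_mat n * clock_mat n * mat_adjoint (shift_mat n)) $$ (i, j)
    = (?w \<cdot>\<^sub>m clock_mat n) $$ (i, j)" .
qed (simp_all add: shift_mat_def clock_mat_def mat_diag_def mat_adjoint_def)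


section \<open>Operators on vector-valued square-integrable functions\<close>

text \<open>\<open>L\<^sup>2(X, \<mu>) \<otimes> \<complex>\<^sup>n\<close> and \<open>L\<^sup>\<infinity>(X, \<mu>) \<otimes> M\<^sub>n\<close> are represented by functions with values
  in \<open>\<complex>\<^sup>n\<close> and \<open>M\<^sub>n\<close>, all of whose entries are square-integrable, respectively essentially
  bounded and measurable. These are representatives: operators are compared almost everywhere.\<close>

definition L2_vec :: "'b measure \<Rightarrow> nat \<Rightarrow> ('b \<Rightarrow> complex Matrix.vec) set" where
  "L2_vec M n = {\<xi>. (\<forall>x\<in>space M. \<xi> x \<in> carrier_vec n)
     \<and> (\<forall>i<n. (\<lambda>x. vec_index (\<xi> x) i) \<in> borel_measurable M
          \<and> integrable M (\<lambda>x. (cmod (vec_index (\<xi> x) i))\<^sup>2))}"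

definition Linf_mat :: "'b measure \<Rightarrow> nat \<Rightarrow> ('b \<Rightarrow> complex mat) set" where
  "Linf_mat M n = {A. (\<forall>x\<in>space M. A x \<in> carrier_mat n n)
     \<and> (\<forall>i<n. \<forall>j<n. (\<lambda>x. A x $$ (i, j)) \<in> borel_measurable M
          \<and> (\<exists>B. AE x in M. cmod (A x $$ (i, j)) \<le> B))}"

definition Linf_unitary :: "'b measure \<Rightarrow> nat \<Rightarrow> ('b \<Rightarrow> complex mat) set" where
  "Linf_unitary M n = {\<zeta> \<in> Linf_mat M n. AE x in M. unitary_mat n (\<zeta> x)}"

type_synonym 'b vec_op = "('b \<Rightarrow> complex Matrix.vec) \<Rightarrow> 'b \<Rightarrow> complex Matrix.vec"

definition mult_op :: "('b \<Rightarrow> complex mat) \<Rightarrow> 'b vec_op" where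
  "mult_op A \<xi> = (\<lambda>x. A x *\<^sub>v \<xi> x)"

definition V_op :: "(int \<Rightarrow> 'a) vec_op" where
  "V_op \<xi> = (\<lambda>x. \<xi> (inv_into UNIV right_shift x))"

definition op_eq :: "'b measure \<Rightarrow> nat \<Rightarrow> 'b vec_op \<Rightarrow> 'b vec_op \<Rightarrow> bool" where
  "op_eq M n S T \<longleftrightarrow> (\<forall>\<xi>\<in>L2_vec M n. AE x in M. S \<xi> x = T \<xi> x)"

text \<open>The implementing unitary is required to lie in \<open>L\<^sup>\<infinity>(X, \<mu>) \<otimes> M\<^sub>n\<close>, not merely in
  the bounded operators.\<close>

definition unitarily_equivalent :: "'b measure \<Rightarrow> nat \<Rightarrow> 'b vec_op \<Rightarrow> 'b vec_op \<Rightarrow> bool" where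
  "unitarily_equivalent M n S T \<longleftrightarrow>
     (\<exists>\<zeta>\<in>Linf_unitary M n.
        op_eq M n S (mult_op \<zeta> \<circ> T \<circ> mult_op (\<lambda>x. mat_adjoint (\<zeta> x))))"

definition W_fun :: "nat \<Rightarrow> 'b set \<Rightarrow> 'b set \<Rightarrow> 'b \<Rightarrow> complex mat" where
  "W_fun n C D x = indicator C x \<cdot>\<^sub>m mat_adjoint (clock_mat n)
     + indicator D x \<cdot>\<^sub>m mat_adjoint (shift_mat n)"

end

theory Submission
  imports Defs
begin

text \<open>
  A unitary \<open>\<zeta>\<close> implementing the equivalence satisfies \<open>W(x) \<zeta>(\<sigma>\<^sup>-\<^sup>1 x) = \<zeta>(x) W'(x)\<close>
  almost everywhere, where \<open>W(x)\<close> and \<open>W'(x)\<close> depend only on \<open>x\<^sub>0\<close> and act isometrically on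
  matrices. If \<open>x\<close> and \<open>y\<close> have the same future, then \<open>\<zeta>(x) - \<zeta>(y)\<close> therefore has the same norm
  as \<open>\<zeta>(\<sigma>\<^sup>-\<^sup>k x) - \<zeta>(\<sigma>\<^sup>-\<^sup>k y)\<close>, and the latter tends to \<open>0\<close> in mean, since the shifted points
  agree on larger and larger half-lines. So \<open>\<zeta>\<close> is a function of the future, by symmetry also a
  function of the past, and by independence a constant \<open>Z\<close>. Comparing letters, \<open>u \<noteq> v\<close> forces
  \<open>C\<^sub>1'\<close> to be the complement of \<open>C\<^sub>1\<close>, and then conjugation by \<open>Z\<close> exchanges \<open>u\<^sup>*\<close> and \<open>v\<^sup>*\<close>. The
  commutation relation of \<open>u\<close> and \<open>v\<close> now gives \<open>\<omega>\<^sup>2 = 1\<close>, that is \<open>n = 2\<close>. Conversely, for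
  \<open>n = 2\<close> the Hadamard matrix exchanges \<open>u\<close> and \<open>v\<close>.
\<close>

section \<open>Bernoulli shifts and cocycles\<close>

text \<open>Two independent samples of the Bernoulli process are coded as one sample indexed by
  \<open>int \<times> bool\<close>, so that every coupling used below is a reindexing along an injection.\<close>

definition double_bernoulli :: "'a measure \<Rightarrow> (int \<times> bool \<Rightarrow> 'a) measure" where
  "double_bernoulli m = (\<Pi>\<^sub>M i\<in>(UNIV :: (int \<times> bool) set). m)"

text \<open>Coordinates in \<open>J\<close> come from the first sample, all others from the second.\<close>

definition mix :: "int set \<Rightarrow> (int \<times> bool \<Rightarrow> 'a) \<Rightarrow> int \<Rightarrow> 'a" where
  "mix J \<omega> = (\<lambda>i. \<omega> (i, i \<in> J))"

text \<open>The inverse of \<open>right_shift\<close>, hence the map through which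
  \<open>V_op\<close> acts.\<close>

definition left_shift :: "(int \<Rightarrow> 'a) \<Rightarrow> int \<Rightarrow> 'a" where
  "left_shift x = (\<lambda>i. x (i + 1))"

definition double_shift :: "(int \<times> bool \<Rightarrow> 'a) \<Rightarrow> int \<times> bool \<Rightarrow> 'a" where
  "double_shift \<omega> = (\<lambda>(i, b). \<omega> (i + 1, b))"

definition double_flip :: "(int \<times> bool \<Rightarrow> 'a) \<Rightarrow> int \<times> bool \<Rightarrow> 'a" where
  "double_flip \<omega> = (\<lambda>(i, b). \<omega> (i, \<not> b))"

text \<open>Exchanging the two samples turns a comparison of \<open>mix UNIV\<close> with
  \<open>mix J\<close> into one of \<open>mix {}\<close> with \<open>mix (- J)\<close>.\<close>

lemma mix_double_flip: "mix J (double_flip \<omega>) = mix (- J) \<omega>"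
  by (simp add: mix_def double_flip_def)

text \<open>After the shift, position \<open>i\<close> reads the old position \<open>i + 1\<close>,
  so the set of positions taken from the first sample moves forward by one. Each use of the cocycle
  relation thereby translates \<open>J\<close>.\<close>

lemma mix_double_shift: "mix J (double_shift \<omega>) = left_shift (mix ((\<lambda>i. i + 1) ` J) \<omega>)"
proof
  fix i
  have "i \<in> J \<longleftrightarrow> i + 1 \<in> (\<lambda>i. i + 1) ` J" by force
  then show "mix J (double_shift \<omega>) i = left_shift (mix ((\<lambda>i. i + 1) ` J) \<omega>) i"
    by (simp add: mix_def double_shift_def left_shift_def)
qed

text \<open>An injection selects distinct coordinates of an i.i.d. family, and these are again
  i.i.d. with the same law.\<close>

lemma distr_PiM_const_reindex:
  assumes "prob_space m" and "inj f"
  shows "distr (\<Pi>\<^sub>M i\<in>UNIV. m) (\<Pi>\<^sub>M i\<in>UNIV. m) (\<lambda>\<omega> n. \<omega> (f n)) = (\<Pi>\<^sub>M i\<in>UNIV. m)"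
  using distr_PiM_reindex[of UNIV "\<lambda>_. m" f UNIV] assms by (simp add: restrict_UNIV)

context prob_space
begin

lemma prob_space_bernoulli: "prob_space (bernoulli_measure M)"
  unfolding bernoulli_measure_def by (intro prob_space_PiM prob_space_axioms)

lemma measurable_mix [measurable]:
  "mix J \<in> measurable (double_bernoulli M) (bernoulli_measure M)"
  unfolding mix_def double_bernoulli_def bernoulli_measure_def
  by (rule measurable_PiM_single') (auto simp: space_PiM)

lemma measurable_left_shift [measurable]:
  "left_shift \<in> measurable (bernoulli_measure M) (bernoulli_measure M)"
  unfolding left_shift_def bernoulli_measure_def
  by (rule measurable_PiM_single') (auto simp: space_PiM)

lemma measurable_double_shift [measurable]:
  "double_shift \<in> measurable (double_bernoulli M) (double_bernoulli M)"
  unfolding double_shift_def double_bernoulli_def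
  by (rule measurable_PiM_single') (auto simp: space_PiM)

lemma measurable_double_flip [measurable]:
  "double_flip \<in> measurable (double_bernoulli M) (double_bernoulli M)"
  unfolding double_flip_def double_bernoulli_def
  by (rule measurable_PiM_single') (auto simp: space_PiM)

text \<open>The positions \<open>(i, i \<in> J)\<close> are distinct for distinct \<open>i\<close>,
  so every splice of the two samples is itself a Bernoulli sample.\<close>

lemma distr_mix: "distr (double_bernoulli M) (bernoulli_measure M) (mix J) = bernoulli_measure M"
  unfolding double_bernoulli_def bernoulli_measure_def mix_def
  by (rule distr_PiM_const_reindex[OF prob_space_axioms]) (simp add: inj_on_def)

lemma distr_left_shift:
  "distr (bernoulli_measure M) (bernoulli_measure M) left_shift = bernoulli_measure M"
  unfolding bernoulli_measure_def left_shift_def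
  by (rule distr_PiM_const_reindex[OF prob_space_axioms]) (simp add: inj_on_def)

lemma distr_double_shift:
  "distr (double_bernoulli M) (double_bernoulli M) double_shift = double_bernoulli M"
proof -
  have "inj (\<lambda>(i, b). (i + 1, b) :: int \<times> bool)"
    by (auto simp: inj_on_def)
  from distr_PiM_const_reindex[OF prob_space_axioms this] show ?thesis
    by (simp add: double_bernoulli_def double_shift_def[abs_def] case_prod_beta')
qed

lemma distr_double_flip:
  "distr (double_bernoulli M) (double_bernoulli M) double_flip = double_bernoulli M"
proof -
  have "inj (\<lambda>(i, b). (i, \<not> b) :: int \<times> bool)"
    by (auto simp: inj_on_def)
  from distr_PiM_const_reindex[OF prob_space_axioms this] show ?thesis
    by (simp add: double_bernoulli_def double_flip_def[abs_def] case_prod_beta')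
qed

lemma integrable_mix:
  fixes f :: "_ \<Rightarrow> 'b::{banach, second_countable_topology}"
  shows "integrable (bernoulli_measure M) f \<Longrightarrow> integrable (double_bernoulli M) (\<lambda>\<omega>. f (mix J \<omega>))"
  using integrable_distr[OF measurable_mix, of J f] by (simp add: distr_mix)

lemma integral_mix:
  fixes f :: "_ \<Rightarrow> 'b::{banach, second_countable_topology}"
  assumes [measurable]: "f \<in> borel_measurable (bernoulli_measure M)"
  shows "(\<integral>\<omega>. f (mix J \<omega>) \<partial>double_bernoulli M) = (\<integral>x. f x \<partial>bernoulli_measure M)"
  using integral_distr[OF measurable_mix assms, of J] by (simp add: distr_mix)

lemma AE_mix:
  assumes "AE x in bernoulli_measure M. P x"
  shows "AE \<omega> in double_bernoulli M. P (mix J \<omega>)"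
  by (rule AE_distrD[OF measurable_mix]) (simp only: distr_mix assms)

section \<open>Continuity in mean under resampling\<close>

definition mix_continuous :: 
  "(nat \<Rightarrow> int set) \<Rightarrow> ((int \<Rightarrow> 'a) \<Rightarrow> 'b::{banach, second_countable_topology}) \<Rightarrow> bool" where
  "mix_continuous J f \<longleftrightarrow> integrable (bernoulli_measure M) f
    \<and> (\<lambda>k. \<integral>\<omega>. norm (f (mix UNIV \<omega>) - f (mix (J k) \<omega>)) \<partial>double_bernoulli M) \<longlonglongrightarrow> 0"

lemma mix_continuous_L1_le:
  fixes f g :: "(int \<Rightarrow> 'a) \<Rightarrow> 'b::{banach, second_countable_topology}"
  assumes f: "integrable (bernoulli_measure M) f" and g: "integrable (bernoulli_measure M) g"
  shows "(\<integral>\<omega>. norm (f (mix UNIV \<omega>) - f (mix J \<omega>)) \<partial>double_bernoulli M)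
    \<le> 2 * (\<integral>x. norm (f x - g x) \<partial>bernoulli_measure M)
      + (\<integral>\<omega>. norm (g (mix UNIV \<omega>) - g (mix J \<omega>)) \<partial>double_bernoulli M)"
    (is "?l \<le> 2 * ?d + ?r")
proof -
  note [intro!] = Bochner_Integration.integrable_norm Bochner_Integration.integrable_diff
    integrable_mix[OF f] integrable_mix[OF g] Bochner_Integration.integrable_add
  have d: "(\<integral>\<omega>. norm (f (mix J \<omega>) - g (mix J \<omega>)) \<partial>double_bernoulli M) = ?d" for J
    using f g by (intro integral_mix) auto
  have "?l \<le> (\<integral>\<omega>. (norm (f (mix UNIV \<omega>) - g (mix UNIV \<omega>))
      + norm (f (mix J \<omega>) - g (mix J \<omega>)))
      + norm (g (mix UNIV \<omega>) - g (mix J \<omega>)) \<partial>double_bernoulli M)"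
  proof (intro integral_mono)
    fix \<omega>
    let ?a = "f (mix UNIV \<omega>)" and ?b = "g (mix UNIV \<omega>)" and ?c = "g (mix J \<omega>)" and ?e = "f (mix J \<omega>)"
    have "norm (?a - ?e) = norm ((?a - ?b) + (?b - ?c) - (?e - ?c))" by simp
    also have "\<dots> \<le> norm (?a - ?b) + norm (?b - ?c) + norm (?e - ?c)"
      by (intro order.trans[OF norm_triangle_ineq4] add_mono norm_triangle_ineq order.refl)
    finally show "norm (?a - ?e) \<le> norm (?a - ?b) + norm (?e - ?c) + norm (?b - ?c)" by simp
  qed auto
  also have "\<dots> = 2 * ?d + ?r"
    by (subst Bochner_Integration.integral_add, (auto simp: d)[2],
        subst Bochner_Integration.integral_add, auto simp: d)
  finally show ?thesis .
qed

lemma mix_continuous_L1_limit: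
  fixes f :: "(int \<Rightarrow> 'a) \<Rightarrow> 'b::{banach, second_countable_topology}"
  assumes f: "integrable (bernoulli_measure M) f" and g: "\<And>n. mix_continuous J (g n)"
    and lim: "(\<lambda>n::nat. \<integral>x. norm (f x - g n x) \<partial>bernoulli_measure M) \<longlonglongrightarrow> 0"
  shows "mix_continuous J f"
  unfolding mix_continuous_def
proof (intro conjI f, rule LIMSEQ_I)
  fix e :: real assume "e > 0"
  \<comment> \<open>The approximation error enters twice and the distance for \<open>g n\<close>
    once, which adds up to less than \<open>3 * e / 4\<close>.\<close>
  then have e: "e / 4 > 0" by simp
  obtain n where n: "norm (\<integral>x. norm (f x - g n x) \<partial>bernoulli_measure M) < e / 4"
    using LIMSEQ_D[OF lim e] by auto
  have "(\<lambda>k. \<integral>\<omega>. norm (g n (mix UNIV \<omega>) - g n (mix (J k) \<omega>)) \<partial>double_bernoulli M) \<longlonglongrightarrow> 0"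
    using g[of n] unfolding mix_continuous_def by blast
  from LIMSEQ_D[OF this e] obtain K where K: "\<And>k. k \<ge> K \<Longrightarrow>
      norm ((\<integral>\<omega>. norm (g n (mix UNIV \<omega>) - g n (mix (J k) \<omega>)) \<partial>double_bernoulli M) - 0) < e / 4"
    by blast
  have "norm ((\<integral>\<omega>. norm (f (mix UNIV \<omega>) - f (mix (J k) \<omega>)) \<partial>double_bernoulli M) - 0) < e"
    if "k \<ge> K" for k
  proof -
    have gi: "integrable (bernoulli_measure M) (g n)"
      using g[of n] unfolding mix_continuous_def by blast
    show ?thesis
      using mix_continuous_L1_le[OF f gi, of "J k"] n K[OF that] \<open>e > 0\<close> by simp
  qed
  then show "\<exists>K. \<forall>k\<ge>K. norm ((\<integral>\<omega>. norm (f (mix UNIV \<omega>) - f (mix (J k) \<omega>)) \<partial>double_bernoulli M) - 0) < e"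
    by blast
qed

lemma mix_continuous_add:
  assumes f: "mix_continuous J f" and g: "mix_continuous J g"
  shows "mix_continuous J (\<lambda>x. f x + g x)"
  unfolding mix_continuous_def
proof (intro conjI)
  note int = f[unfolded mix_continuous_def, THEN conjunct1] g[unfolded mix_continuous_def, THEN conjunct1]
  note [intro!] = Bochner_Integration.integrable_norm Bochner_Integration.integrable_diff
    integrable_mix[OF int(1)] integrable_mix[OF int(2)] Bochner_Integration.integrable_add
  show "integrable (bernoulli_measure M) (\<lambda>x. f x + g x)" using int by auto
  let ?d = "\<lambda>f k. \<integral>\<omega>. norm (f (mix UNIV \<omega>) - f (mix (J k) \<omega>)) \<partial>double_bernoulli M"
  show "?d (\<lambda>x. f x + g x) \<longlonglongrightarrow> 0"
  proof (rule tendsto_sandwich[OF _ _ tendsto_const, of _ _ _ "\<lambda>k. ?d f k + ?d g k"])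
    show "(\<lambda>k. ?d f k + ?d g k) \<longlonglongrightarrow> 0"
      using tendsto_add[OF f[unfolded mix_continuous_def, THEN conjunct2]
        g[unfolded mix_continuous_def, THEN conjunct2]] by simp
    have "?d (\<lambda>x. f x + g x) k \<le> ?d f k + ?d g k" for k
      by (subst Bochner_Integration.integral_add[symmetric])
        (auto intro!: integral_mono norm_diff_triangle_ineq)
    then show "\<forall>\<^sub>F k in sequentially. ?d (\<lambda>x. f x + g x) k \<le> ?d f k + ?d g k" by simp
  qed simp
qed

text \<open>A cylinder depends on finitely many coordinates, all of which eventually lie in
  \<open>J k\<close>. The property then spreads from this intersection-stable generator to the whole
  \<sigma>-algebra through complements and disjoint unions.\<close>

lemma mix_continuous_indicator:
  assumes A: "A \<in> sets (bernoulli_measure M)"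
    and J: "\<And>i. \<forall>\<^sub>F k in sequentially. i \<in> J k"
  shows "mix_continuous J (indicator A :: _ \<Rightarrow> real)"
proof -
  interpret B: prob_space "bernoulli_measure M" by (rule prob_space_bernoulli)
  let ?S = "\<Pi>\<^sub>E i\<in>(UNIV :: int set). space M" and ?G = "prod_algebra UNIV (\<lambda>_::int. M)"
  have sets: "sets (bernoulli_measure M) = sigma_sets ?S ?G"
    and space: "space (bernoulli_measure M) = ?S"
    by (simp_all add: bernoulli_measure_def sets_PiM space_PiM)
  have mix: "mix K \<omega> \<in> ?S" if "\<omega> \<in> space (double_bernoulli M)" for K \<omega>
    using measurable_space[OF measurable_mix that] by (simp add: space)
  have ind: "integrable (bernoulli_measure M) (indicator B :: _ \<Rightarrow> real)"
    if "B \<in> sigma_sets ?S ?G" for B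
    using that unfolding sets[symmetric] by (simp add: B.emeasure_eq_measure)
  show ?thesis
    using Int_stable_prod_algebra prod_algebra_sets_into_space A[unfolded sets]
  proof (induction A rule: sigma_sets_induct_disjoint)
    case (basic A)
    then obtain F E where A: "A = prod_emb UNIV (\<lambda>_. M) F (\<Pi>\<^sub>E j\<in>F. E j)" and F: "finite F"
      by (metis prod_algebraE)
    have "\<forall>\<^sub>F k in sequentially. \<forall>i\<in>F. i \<in> J k"
      using F J by (simp add: eventually_ball_finite)
    then have "\<forall>\<^sub>F k in sequentially. 0 =
        (\<integral>\<omega>. norm (indicator A (mix UNIV \<omega>) - indicator A (mix (J k) \<omega>) :: real) \<partial>double_bernoulli M)"
    proof eventually_elim
      case (elim k)
      have "mix UNIV \<omega> \<in> A \<longleftrightarrow> mix (J k) \<omega> \<in> A" if "\<omega> \<in> space (double_bernoulli M)" for \<omega>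
      proof -
        have "mix K \<omega> \<in> A \<longleftrightarrow> (\<forall>i\<in>F. mix K \<omega> i \<in> E i)" for K
          using mix[OF that, of K] by (simp add: A prod_emb_def PiE_iff Pi_iff)
        from this[of UNIV] this[of "J k"] show ?thesis using elim by (simp add: mix_def)
      qed
      then have "(\<integral>\<omega>. norm (indicator A (mix UNIV \<omega>) - indicator A (mix (J k) \<omega>) :: real) \<partial>double_bernoulli M)
        = (\<integral>\<omega>. 0 \<partial>double_bernoulli M)"
        by (intro Bochner_Integration.integral_cong) (auto simp: indicator_def)
      then show ?case by simp
    qed
    then have "(\<lambda>k. \<integral>\<omega>. norm (indicator A (mix UNIV \<omega>) - indicator A (mix (J k) \<omega>) :: real) 
        \<partial>double_bernoulli M) \<longlonglongrightarrow> 0"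
      by (rule Lim_transform_eventually[OF tendsto_const])
    then show ?case
      using ind[of A] basic unfolding mix_continuous_def by auto
  next
    case empty
    show ?case by (simp add: mix_continuous_def)
  next
    case (compl A)
    \<comment> \<open>Both splices lie in the space, so passing to the complement flips both
      indicators and keeps their distance.\<close>
    have "(\<integral>\<omega>. norm (indicator (?S - A) (mix UNIV \<omega>) - indicator (?S - A) (mix K \<omega>) :: real) \<partial>double_bernoulli M)
        = (\<integral>\<omega>. norm (indicator A (mix UNIV \<omega>) - indicator A (mix K \<omega>) :: real) \<partial>double_bernoulli M)" for K
      using mix by (intro Bochner_Integration.integral_cong) (auto simp: indicator_def)
    then show ?case
      using compl ind[of "?S - A"] unfolding mix_continuous_def
      by (simp add: sigma_sets.Compl)
  next
    case (union A)
    let ?A = "\<lambda>n::nat. \<Union>i<n. A i"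
    have [measurable]: "A i \<in> sets (bernoulli_measure M)" for i
      using union by (auto simp: sets)
    \<comment> \<open>Disjointness makes the indicator of a finite partial union a sum of
      indicators; the full union is then an \<open>L1\<close> limit of these.\<close>
    have fin: "mix_continuous J (indicator (?A n) :: _ \<Rightarrow> real)" for n
    proof (induction n)
      case 0 show ?case by (simp add: mix_continuous_def)
    next
      case (Suc n)
      have "A n \<inter> ?A n = {}"
        using disjoint_family_onD[OF union(1), of n] by fastforce
      then have "(indicator (?A (Suc n)) :: _ \<Rightarrow> real) = (\<lambda>x. indicator (?A n) x + indicator (A n) x)"
        by (intro ext) (auto simp: lessThan_Suc indicator_def)
      then show ?case
        using mix_continuous_add[OF Suc union(3)] by simp
    qed
    show ?case
    proof (rule mix_continuous_L1_limit)
      show "integrable (bernoulli_measure M) (indicator (\<Union>i. A i) :: _ \<Rightarrow> real)"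
        using union by (intro ind sigma_sets.Union) auto
      show "(\<lambda>n. \<integral>x. norm (indicator (\<Union>i. A i) x - indicator (?A n) x :: real) \<partial>bernoulli_measure M) \<longlonglongrightarrow> 0"
      proof -
        have "(\<lambda>n. \<integral>x. norm (indicator (\<Union>i. A i) x - indicator (?A n) x :: real) \<partial>bernoulli_measure M)
          \<longlonglongrightarrow> (\<integral>x. 0 \<partial>bernoulli_measure M)"
        proof (rule integral_dominated_convergence[where w = "\<lambda>_. 1"])
          show "AE x in bernoulli_measure M. 
            (\<lambda>n. norm (indicator (\<Union>i. A i) x - indicator (?A n) x :: real)) \<longlonglongrightarrow> 0"
          proof (intro AE_I2 tendsto_norm_zero)
            fix x
            have "(\<lambda>n. indicator (?A n) x :: real) \<longlonglongrightarrow> indicator (\<Union>i. A i) x"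
              by (rule LIMSEQ_indicator_UN)
            from tendsto_diff[OF tendsto_const this, of "indicator (\<Union>i. A i) x"]
            show "(\<lambda>n. indicator (\<Union>i. A i) x - indicator (?A n) x :: real) \<longlonglongrightarrow> 0"
              by simp
          qed
        qed (auto simp: indicator_def)
        then show ?thesis by simp
      qed
    qed (rule fin)
  qed
qed

text \<open>Multiples of indicators, sums and dominated limits reach every integrable function, so
  each is determined in mean up to a small error by the coordinates in \<open>J k\<close> for large
  \<open>k\<close>.\<close>

lemma mix_continuous_integrable:
  fixes f :: "(int \<Rightarrow> 'a) \<Rightarrow> 'b::{banach, second_countable_topology}"
  assumes f: "integrable (bernoulli_measure M) f"
    and J: "\<And>i. \<forall>\<^sub>F k in sequentially. i \<in> J k"
  shows "mix_continuous J f"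
  using f
proof (induction rule: integrable_induct)
  case (base A c)
  have ind: "mix_continuous J (indicator A :: _ \<Rightarrow> real)"
    using mix_continuous_indicator[OF base(1) J] .
  have "norm (indicator A x *\<^sub>R c - indicator A y *\<^sub>R c) = norm (indicator A x - indicator A y :: real) * norm c" for x y
    by (simp add: scaleR_diff_left[symmetric])
  moreover have "integrable (bernoulli_measure M) (\<lambda>x. indicator A x *\<^sub>R c)"
    using ind unfolding mix_continuous_def by simp
  ultimately show ?case
    using ind unfolding mix_continuous_def by (auto intro: tendsto_mult_left_zero)
next
  case (add f g)
  then show ?case by (intro mix_continuous_add)
next
  case (lim f s)
  note [measurable] = lim.hyps(1,4)[THEN borel_measurable_integrable]
  have "(\<lambda>n. \<integral>x. norm (f x - s n x) \<partial>bernoulli_measure M) \<longlonglongrightarrow> (\<integral>x. 0 \<partial>bernoulli_measure M)"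
  \<comment> \<open>The approximants satisfy \<open>norm (s n x) \<le> 2 * norm (f x)\<close>, which
    explains the factor 3.\<close>
  proof (rule integral_dominated_convergence[where w = "\<lambda>x. 3 * norm (f x)"])
    show "AE x in bernoulli_measure M. (\<lambda>n. norm (f x - s n x)) \<longlonglongrightarrow> 0"
    proof (intro AE_I2 tendsto_norm_zero)
      fix x assume "x \<in> space (bernoulli_measure M)"
      from tendsto_diff[OF tendsto_const[of "f x"] lim.hyps(2)[OF this]]
      show "(\<lambda>n. f x - s n x) \<longlonglongrightarrow> 0" by simp
    qed
    show "AE x in bernoulli_measure M. norm (norm (f x - s n x)) \<le> 3 * norm (f x)" for n
    proof (rule AE_I2)
      fix x assume "x \<in> space (bernoulli_measure M)"
      from lim.hyps(3)[OF this, of n] norm_triangle_ineq4[of "f x" "s n x"]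
      show "norm (norm (f x - s n x)) \<le> 3 * norm (f x)" by simp
    qed
  qed (use lim.hyps(4) in auto)
  then show ?case
    using lim.IH by (intro mix_continuous_L1_limit[OF lim.hyps(4), of J s]) auto
qed

end

lemma image_plus_one: "(\<lambda>i::int. i + 1) ` A = {i. i - 1 \<in> A}"
  by force

section \<open>Independence of the two samples and rigidity of isometric cocycles\<close>

definition interleave :: "(int \<Rightarrow> 'a) \<times> (int \<Rightarrow> 'a) \<Rightarrow> int \<times> bool \<Rightarrow> 'a" where
  "interleave = (\<lambda>(x, y) (i, b). if b then x i else y i)"

context prob_space
begin

lemma measurable_interleave [measurable]:
  "interleave \<in> measurable (bernoulli_measure M \<Otimes>\<^sub>M bernoulli_measure M) (double_bernoulli M)"
  unfolding double_bernoulli_def bernoulli_measure_def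
  by (rule measurable_PiM_single')
    (auto simp: interleave_def space_PiM space_pair_measure case_prod_beta' PiE_iff)

text \<open>A product measure is determined by finite-dimensional cylinders, and the preimage of
  such a cylinder under \<open>interleave\<close> is a rectangle of two cylinders, one for each tag.
  Its measure is the product over both slices of \<open>J\<close>.\<close>

lemma distr_pair_double_bernoulli:
  "distr (bernoulli_measure M \<Otimes>\<^sub>M bernoulli_measure M) (double_bernoulli M)
     interleave = double_bernoulli M" (is "distr ?B2 ?D _ = ?D")
proof -
  interpret B: prob_space "bernoulli_measure M" by (rule prob_space_bernoulli)
  interpret PB: product_prob_space "\<lambda>_. M" "UNIV :: int set" by unfold_locales
  interpret P: product_prob_space "\<lambda>_. M" "UNIV :: (int \<times> bool) set" by unfold_locales
  show ?thesis
  proof (subst (2) double_bernoulli_def, rule P.PiM_eq)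
    show "sets (distr ?B2 ?D interleave) = sets (\<Pi>\<^sub>M i\<in>(UNIV :: (int \<times> bool) set). M)"
      by (simp add: double_bernoulli_def)
    fix J :: "(int \<times> bool) set" and F
    assume J: "finite J" and F: "\<And>j. j \<in> J \<Longrightarrow> F j \<in> sets M"
    define K where "K b = {i. (i, b) \<in> J}" for b
    have J_eq: "J = (\<lambda>i. (i, True)) ` K True \<union> (\<lambda>i. (i, False)) ` K False"
    proof (intro equalityI subsetI)
      fix j assume "j \<in> J"
      then show "j \<in> (\<lambda>i. (i, True)) ` K True \<union> (\<lambda>i. (i, False)) ` K False"
        by (cases j; cases "snd j") (auto simp: K_def)
    qed (auto simp: K_def)
    have finK: "finite (K b)" for b
      using finite_vimageI[OF J, of "\<lambda>i. (i, b)"] by (simp add: K_def vimage_def inj_on_def)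
    let ?E = "\<lambda>b. prod_emb UNIV (\<lambda>_. M) (K b) (\<Pi>\<^sub>E i\<in>K b. F (i, b))"
    have FK: "i \<in> K b \<Longrightarrow> F (i, b) \<in> sets M" for i b by (simp add: K_def F)
    have E: "?E b \<in> sets (bernoulli_measure M)" for b
      unfolding bernoulli_measure_def using finK FK by (intro sets_PiM_I) auto
    have vimage: "interleave -` prod_emb UNIV (\<lambda>_. M) J (Pi\<^sub>E J F) \<inter> space ?B2 = ?E True \<times> ?E False"
    proof (rule Set.set_eqI)
      fix z :: "(int \<Rightarrow> 'a) \<times> (int \<Rightarrow> 'a)"
      obtain x y where z: "z = (x, y)" by (cases z)
      have "z \<in> interleave -` prod_emb UNIV (\<lambda>_. M) J (Pi\<^sub>E J F) \<inter> space ?B2 \<longleftrightarrow>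
        (\<forall>i. x i \<in> space M) \<and> (\<forall>i. y i \<in> space M) \<and> (\<forall>j\<in>J. interleave (x, y) j \<in> F j)"
        by (auto simp: z interleave_def prod_emb_def PiE_iff space_pair_measure bernoulli_measure_def space_PiM)
      also have "(\<forall>j\<in>J. interleave (x, y) j \<in> F j) \<longleftrightarrow>
        (\<forall>i\<in>K True. x i \<in> F (i, True)) \<and> (\<forall>i\<in>K False. y i \<in> F (i, False))"
        by (subst J_eq) (simp add: interleave_def ball_Un)
      finally show "z \<in> interleave -` prod_emb UNIV (\<lambda>_. M) J (Pi\<^sub>E J F) \<inter> space ?B2 \<longleftrightarrow> z \<in> ?E True \<times> ?E False"
        by (auto simp: z prod_emb_def PiE_iff)
    qed
    have "emeasure (distr ?B2 ?D interleave) (prod_emb UNIV (\<lambda>_. M) J (Pi\<^sub>E J F)) = emeasure ?B2 (?E True \<times> ?E False)"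
      unfolding vimage[symmetric]
      using J F by (intro emeasure_distr measurable_interleave) (auto simp: double_bernoulli_def intro!: sets_PiM_I)
    also have "\<dots> = emeasure (bernoulli_measure M) (?E True) * emeasure (bernoulli_measure M) (?E False)"
      by (intro B.emeasure_pair_measure_Times E)
    also have "\<dots> = (\<Prod>i\<in>K True. emeasure M (F (i, True))) * (\<Prod>i\<in>K False. emeasure M (F (i, False)))"
      unfolding bernoulli_measure_def using finK FK by (simp add: PB.emeasure_PiM_emb)
    also have "\<dots> = (\<Prod>j\<in>J. emeasure M (F j))"
      by (subst J_eq, subst prod.union_disjoint) (auto simp: finK prod.reindex inj_on_def)
    finally show "emeasure (distr ?B2 ?D interleave) (prod_emb UNIV (\<lambda>_. M) J (Pi\<^sub>E J F)) = (\<Prod>j\<in>J. emeasure M (F j))" .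
  qed
qed

text \<open>\<open>mix UNIV\<close> and \<open>mix {}\<close> recover the two independent samples,
  so this is Fubini for null sets.\<close>

lemma AE_double_bernoulliD:
  assumes "AE \<omega> in double_bernoulli M. P (mix UNIV \<omega>) (mix {} \<omega>)"
  shows "AE x in bernoulli_measure M. AE y in bernoulli_measure M. P x y"
proof -
  interpret B: prob_space "bernoulli_measure M" by (rule prob_space_bernoulli)
  interpret BB: pair_prob_space "bernoulli_measure M" "bernoulli_measure M" by unfold_locales
  have "AE z in bernoulli_measure M \<Otimes>\<^sub>M bernoulli_measure M. P (mix UNIV (interleave z)) (mix {} (interleave z))"
    by (rule AE_distrD[OF measurable_interleave]) (simp only: distr_pair_double_bernoulli assms)
  from BB.AE_pair[OF this] show ?thesis by (simp add: mix_def interleave_def)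
qed

text \<open>The expected distance \<open>I(J)\<close> between the values of \<open>f\<close> at \<open>x\<close> and at a copy of \<open>x\<close>
  resampled off \<open>J\<close> is unchanged when \<open>J\<close> is translated by one step whose image contains \<open>0\<close>,
  because the two arguments then share the letter governing that step. Translating a half-line
  repeatedly exhausts \<open>UNIV\<close>, where \<open>I\<close> tends to \<open>0\<close>; hence \<open>f\<close> depends only on the past and
  only on the future.\<close>

lemma isometric_cocycle_transfer_constant:
  fixes f :: "'p \<Rightarrow> (int \<Rightarrow> 'a) \<Rightarrow> 'b::{banach, second_countable_topology}"
  assumes P: "finite P"
    and f: "\<And>p. p \<in> P \<Longrightarrow> integrable (bernoulli_measure M) (f p)"
    and Q: "AE x in bernoulli_measure M. Q x"
    and isometric: "\<And>x y. Q x \<Longrightarrow> Q y \<Longrightarrow> x 0 = y 0 \<Longrightarrow>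
      (\<Sum>p\<in>P. norm (f p (left_shift x) - f p (left_shift y))) = (\<Sum>p\<in>P. norm (f p x - f p y))"
  shows "AE x in bernoulli_measure M. AE y in bernoulli_measure M. \<forall>p\<in>P. f p x = f p y"
proof -
  have [measurable]: "f p \<in> borel_measurable (bernoulli_measure M)" if "p \<in> P" for p
    using f[OF that] by auto
  define d where "d J \<omega> = (\<Sum>p\<in>P. norm (f p (mix UNIV \<omega>) - f p (mix J \<omega>)))" for J \<omega>
  have d: "integrable (double_bernoulli M) (d J)" for J
    unfolding d_def
    by (intro Bochner_Integration.integrable_sum integrable_norm Bochner_Integration.integrable_diff
        integrable_mix f)
  have step: "integral\<^sup>L (double_bernoulli M) (d J) = integral\<^sup>L (double_bernoulli M) (d ((\<lambda>i. i + 1) ` J))"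
    if "0 \<in> (\<lambda>i. i + 1) ` J" for J
  proof -
    let ?J = "(\<lambda>i. i + 1) ` J"
    have "integral\<^sup>L (double_bernoulli M) (d J) = (\<integral>\<omega>. d J (double_shift \<omega>) \<partial>double_bernoulli M)"
      using integral_distr[OF measurable_double_shift, of "d J"] d[of J]
      by (simp add: distr_double_shift)
    also have "\<dots> = integral\<^sup>L (double_bernoulli M) (d ?J)"
    proof (rule integral_cong_AE)
      show "(\<lambda>\<omega>. d J (double_shift \<omega>)) \<in> borel_measurable (double_bernoulli M)"
        using d[of J] by measurable
      show "d ?J \<in> borel_measurable (double_bernoulli M)"
        using d[of ?J] by measurable
      show "AE \<omega> in double_bernoulli M. d J (double_shift \<omega>) = d ?J \<omega>"
        using AE_mix[OF Q, of UNIV] AE_mix[OF Q, of ?J]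
      proof eventually_elim
        case (elim \<omega>)
        \<comment> \<open>Position 0 belongs to the translated set, so both splices take this letter
          from the first sample, as \<open>isometric\<close> requires.\<close>
        have "mix UNIV \<omega> 0 = mix ?J \<omega> 0" using that by (simp add: mix_def)
        from isometric[OF elim this] show ?case
          by (simp add: d_def mix_double_shift surj_plus_right)
      qed
    qed
    finally show ?thesis .
  qed
  \<comment> \<open>The integrals are constant in \<open>k\<close> and tend to 0, so they vanish; a
    nonnegative integrand with integral 0 is 0 almost everywhere.\<close>
  have null: "AE \<omega> in double_bernoulli M. \<forall>p\<in>P. f p (mix UNIV \<omega>) = f p (mix (J 0) \<omega>)"
    if J: "\<And>i. \<forall>\<^sub>F k in sequentially. i \<in> J k"
      and inv: "\<And>k. integral\<^sup>L (double_bernoulli M) (d (J (Suc k))) = integral\<^sup>L (double_bernoulli M) (d (J k))"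
    for J
  proof -
    have const: "integral\<^sup>L (double_bernoulli M) (d (J k)) = integral\<^sup>L (double_bernoulli M) (d (J 0))" for k
      by (induction k) (simp_all add: inv)
    have "(\<lambda>k. \<Sum>p\<in>P. \<integral>\<omega>. norm (f p (mix UNIV \<omega>) - f p (mix (J k) \<omega>)) \<partial>double_bernoulli M) \<longlonglongrightarrow> (\<Sum>p\<in>P. 0)"
      using mix_continuous_integrable[OF f J] by (intro tendsto_sum) (simp add: mix_continuous_def)
    moreover have "(\<Sum>p\<in>P. \<integral>\<omega>. norm (f p (mix UNIV \<omega>) - f p (mix (J k) \<omega>)) \<partial>double_bernoulli M)
        = integral\<^sup>L (double_bernoulli M) (d (J 0))" for k
      unfolding const[of k, symmetric] unfolding d_def by (subst Bochner_Integration.integral_sum) (auto intro!: integrable_norm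
        Bochner_Integration.integrable_diff integrable_mix f)
    ultimately have "integral\<^sup>L (double_bernoulli M) (d (J 0)) = 0"
      by (simp add: LIMSEQ_const_iff)
    then have "AE \<omega> in double_bernoulli M. d (J 0) \<omega> = 0"
      using integral_nonneg_eq_0_iff_AE[OF d[of "J 0"]] by (simp add: d_def sum_nonneg)
    then show ?thesis
      by eventually_elim (simp add: d_def sum_nonneg_eq_0_iff P)
  qed
  have "AE \<omega> in double_bernoulli M. \<forall>p\<in>P. f p (mix UNIV \<omega>) = f p (mix {0..} \<omega>)"
  proof -
    \<comment> \<open>Translation shrinks right half-lines, so \<open>step\<close> is read backwards
      here, from \<open>{0..}\<close> towards all integers.\<close>
    have "AE \<omega> in double_bernoulli M. \<forall>p\<in>P. f p (mix UNIV \<omega>) = f p (mix {- int 0..} \<omega>)"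
    proof (rule null[of "\<lambda>k. {- int k..}"])
      show "\<forall>\<^sub>F k in sequentially. i \<in> {- int k..}" for i
        using eventually_ge_at_top[of "nat (- i)"] by eventually_elim auto
      show "integral\<^sup>L (double_bernoulli M) (d {- int (Suc k)..}) = integral\<^sup>L (double_bernoulli M) (d {- int k..})" for k
      proof -
        have "(\<lambda>i. i + 1) ` {- int (Suc k)..} = {- int k..}"
          unfolding image_plus_one by auto
        then show ?thesis using step[of "{- int (Suc k)..}"] by simp
      qed
    qed
    then show ?thesis by simp
  qed
  moreover have "AE \<omega> in double_bernoulli M. \<forall>p\<in>P. f p (mix {} \<omega>) = f p (mix {0..} \<omega>)"
  proof -
    \<comment> \<open>Left half-lines grow under translation. Starting at \<open>{..<0}\<close> is
      possible because \<open>step\<close> asks only that 0 lie in the image, here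
      \<open>{..<1}\<close>.\<close>
    have "AE \<omega> in double_bernoulli M. \<forall>p\<in>P. f p (mix UNIV \<omega>) = f p (mix {..<int 0} \<omega>)"
    proof (rule null[of "\<lambda>k. {..<int k}"])
      show "\<forall>\<^sub>F k in sequentially. i \<in> {..<int k}" for i
        using eventually_gt_at_top[of "nat i"] by eventually_elim auto
      show "integral\<^sup>L (double_bernoulli M) (d {..<int (Suc k)}) = integral\<^sup>L (double_bernoulli M) (d {..<int k})" for k
      proof -
        have "(\<lambda>i. i + 1) ` {..<int k} = {..<int (Suc k)}"
          unfolding image_plus_one by auto
        then show ?thesis using step[of "{..<int k}"] by simp
      qed
    qed
    \<comment> \<open>Exchanging the samples makes the second one agree with
      \<open>mix {0..} \<omega>\<close> as well, so this hybrid point links the values of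
      \<open>f\<close> at two independent samples.\<close>
    then have "AE \<omega> in double_bernoulli M.
        \<forall>p\<in>P. f p (mix UNIV (double_flip \<omega>)) = f p (mix {..<0} (double_flip \<omega>))"
      by (intro AE_distrD[OF measurable_double_flip]) (simp only: distr_double_flip of_nat_0)
    moreover have "- {..<0 :: int} = {0..}" by auto
    ultimately show ?thesis by (simp add: mix_double_flip)
  qed
  ultimately have "AE \<omega> in double_bernoulli M. \<forall>p\<in>P. f p (mix UNIV \<omega>) = f p (mix {} \<omega>)"
    by eventually_elim simp
  then show ?thesis by (rule AE_double_bernoulliD)
qed

end

section \<open>Clock and shift matrices\<close>

definition entry_norm :: "nat \<Rightarrow> complex mat \<Rightarrow> real" where
  "entry_norm n A = (\<Sum>p\<in>{..<n} \<times> {..<n}. cmod (A $$ p))"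

text \<open>The entrywise \<open>\<ell>\<^sup>1\<close> norm is not unitarily invariant, but it is invariant under the
  monomial unitaries, which include \<open>u\<^sup>*\<close> and \<open>v\<^sup>*\<close>.\<close>

definition monomial_unitary :: "nat \<Rightarrow> complex mat \<Rightarrow> bool" where
  "monomial_unitary n A \<longleftrightarrow> A \<in> carrier_mat n n \<and> (\<exists>\<pi> c. bij_betw \<pi> {..<n} {..<n} \<and>
     (\<forall>j<n. cmod (c j) = 1) \<and> (\<forall>i<n. \<forall>j<n. A $$ (i, j) = (if i = \<pi> j then c j else 0)))"

text \<open>Left multiplication by a monomial unitary permutes the rows and multiplies each by a
  phase.\<close>

lemma entry_norm_monomial_mult:
  assumes "monomial_unitary n A" and Z: "Z \<in> carrier_mat n n"
  shows "entry_norm n (A * Z) = entry_norm n Z"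
proof -
  from assms(1) obtain \<pi> c where A: "A \<in> carrier_mat n n"
    and \<pi>: "bij_betw \<pi> {..<n} {..<n}" and c: "\<And>j. j < n \<Longrightarrow> cmod (c j) = 1"
    and Aij: "\<And>i j. i < n \<Longrightarrow> j < n \<Longrightarrow> A $$ (i, j) = (if i = \<pi> j then c j else 0)"
    unfolding monomial_unitary_def by blast
  have lt: "\<pi> k < n" if "k < n" for k using bij_betwE[OF \<pi>] that by simp
  have entry: "(A * Z) $$ (\<pi> k, j) = c k * Z $$ (k, j)" if "k < n" "j < n" for k j
  proof -
    have "(A * Z) $$ (\<pi> k, j) = (\<Sum>l\<in>{0..<n}. A $$ (\<pi> k, l) * Z $$ (l, j))"
      using A Z that lt by (simp add: scalar_prod_def)
    also have "\<dots> = (\<Sum>l\<in>{0..<n}. if l = k then c k * Z $$ (k, j) else 0)"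
      using that lt \<pi> by (intro sum.cong) (auto simp: Aij bij_betw_def inj_on_eq_iff)
    also have "\<dots> = c k * Z $$ (k, j)" using that by simp
    finally show ?thesis .
  qed
  have "entry_norm n (A * Z) = (\<Sum>i<n. \<Sum>j<n. cmod ((A * Z) $$ (i, j)))"
    by (simp add: entry_norm_def sum.cartesian_product)
  also have "\<dots> = (\<Sum>k<n. \<Sum>j<n. cmod ((A * Z) $$ (\<pi> k, j)))"
    by (rule sum.reindex_bij_betw[OF \<pi>, symmetric])
  also have "\<dots> = (\<Sum>k<n. \<Sum>j<n. cmod (Z $$ (k, j)))"
    by (intro sum.cong) (auto simp: entry norm_mult c)
  finally show ?thesis by (simp add: entry_norm_def sum.cartesian_product)
qed

text \<open>The same with columns: column \<open>j\<close> of the product is column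
  \<open>\<pi> j\<close> of \<open>Z\<close> times a phase.\<close>

lemma entry_norm_mult_monomial:
  assumes "monomial_unitary n A" and Z: "Z \<in> carrier_mat n n"
  shows "entry_norm n (Z * A) = entry_norm n Z"
proof -
  from assms(1) obtain \<pi> c where A: "A \<in> carrier_mat n n"
    and \<pi>: "bij_betw \<pi> {..<n} {..<n}" and c: "\<And>j. j < n \<Longrightarrow> cmod (c j) = 1"
    and Aij: "\<And>i j. i < n \<Longrightarrow> j < n \<Longrightarrow> A $$ (i, j) = (if i = \<pi> j then c j else 0)"
    unfolding monomial_unitary_def by blast
  have lt: "\<pi> k < n" if "k < n" for k using bij_betwE[OF \<pi>] that by simp
  have entry: "(Z * A) $$ (i, j) = Z $$ (i, \<pi> j) * c j" if "i < n" "j < n" for i j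
  proof -
    have "(Z * A) $$ (i, j) = (\<Sum>l\<in>{0..<n}. Z $$ (i, l) * A $$ (l, j))"
      using A Z that by (simp add: scalar_prod_def)
    also have "\<dots> = (\<Sum>l\<in>{0..<n}. if l = \<pi> j then Z $$ (i, \<pi> j) * c j else 0)"
      using that by (intro sum.cong) (auto simp: Aij)
    also have "\<dots> = Z $$ (i, \<pi> j) * c j" using that lt by simp
    finally show ?thesis .
  qed
  have "entry_norm n (Z * A) = (\<Sum>i<n. \<Sum>j<n. cmod ((Z * A) $$ (i, j)))"
    by (simp add: entry_norm_def sum.cartesian_product)
  also have "\<dots> = (\<Sum>i<n. \<Sum>j<n. cmod (Z $$ (i, \<pi> j)))"
    by (intro sum.cong) (auto simp: entry norm_mult c)
  also have "\<dots> = (\<Sum>i<n. \<Sum>j<n. cmod (Z $$ (i, j)))"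
    by (intro sum.cong sum.reindex_bij_betw[OF \<pi>]) simp
  finally show ?thesis by (simp add: entry_norm_def sum.cartesian_product)
qed

section \<open>The commutation relation and the exchange of the generators\<close>

lemma adjoint_clock_mat:
  "mat_adjoint (clock_mat n) = mat_diag n (\<lambda>i. cnj (root_of_unity n) ^ i)"
  by (subst mat_adjoint_square[where n = n])
    (auto simp: clock_mat_def mat_diag_def intro!: eq_matI)

lemma adjoint_shift_mat:
  "mat_adjoint (shift_mat n) = Matrix.mat n n (\<lambda>(i, j). if i = (j + 1) mod n then 1 else 0)"
  by (subst mat_adjoint_square[where n = n]) (auto simp: shift_mat_def intro!: eq_matI)

lemma adjoint_generators_carrier [simp]:
  "mat_adjoint (clock_mat n) \<in> carrier_mat n n" "mat_adjoint (shift_mat n) \<in> carrier_mat n n"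
  by (simp_all add: adjoint_clock_mat adjoint_shift_mat mat_diag_def)

lemma cmod_root_of_unity: "cmod (root_of_unity n) = 1"
  by (simp add: root_of_unity_def norm_exp_eq_Re)

lemma root_of_unity_power: "n > 0 \<Longrightarrow> root_of_unity n ^ n = 1"
  unfolding root_of_unity_def by (simp flip: exp_of_nat_mult)

lemma root_of_unity_square_eq_1:
  assumes "n > 0" "root_of_unity n ^ 2 = 1"
  shows "n \<le> 2"
proof -
  have "exp (2 * (2 * of_real pi * \<i> / of_nat n)) = 1"
    using assms(2) unfolding root_of_unity_def exp_double .
  then obtain k :: int where "Im (2 * (2 * of_real pi * \<i> / of_nat n)) = of_int (2 * k) * pi"
    by (auto simp: exp_eq_1)
  then have "4 * pi / real n = 2 * of_int k * pi"
    by simp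
  then have "2 = real_of_int k * real n"
    using assms(1) by (simp add: field_simps)
  then have "real_of_int (k * int n) = real_of_int 2"
    by simp
  then have "k * int n = 2"
    by (simp only: of_int_eq_iff)
  then have "int n dvd 2" by (metis dvd_triv_right)
  then show ?thesis using zdvd_imp_le[of "int n" 2] by simp
qed

lemma monomial_unitary_adjoint_clock: "monomial_unitary n (mat_adjoint (clock_mat n))"
  unfolding monomial_unitary_def
  by (intro conjI exI[of _ "\<lambda>i. i"] exI[of _ "\<lambda>i. cnj (root_of_unity n) ^ i"])
    (auto simp: adjoint_clock_mat mat_diag_def norm_power cmod_root_of_unity bij_betw_def)

lemma bij_betw_cyclic_shift:
  fixes n :: nat
  shows "bij_betw (\<lambda>j. (j + 1) mod n) {..<n} {..<n}"
proof -
  have inj: "inj_on (\<lambda>j. (j + 1) mod n) {..<n}"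
  proof (rule inj_onI)
    fix x y assume "x \<in> {..<n}" "y \<in> {..<n}" "(x + 1) mod n = (y + 1) mod n"
    then show "x = y" by (cases "x + 1 = n"; cases "y + 1 = n") auto
  qed
  have "(\<lambda>j. (j + 1) mod n) ` {..<n} \<subseteq> {..<n}" by auto
  from endo_inj_surj[OF finite_lessThan this inj] inj show ?thesis
    by (simp only: bij_betw_def simp_thms)
qed

lemma monomial_unitary_adjoint_shift: "monomial_unitary n (mat_adjoint (shift_mat n))"
  unfolding monomial_unitary_def
  by (intro conjI exI[of _ "\<lambda>j. (j + 1) mod n"] exI[of _ "\<lambda>_. 1"] bij_betw_cyclic_shift)
    (auto simp: adjoint_shift_mat)

text \<open>The diagonal factor contributes the power of the row index on the left and of the column
  index on the right. These indices differ by one cyclically at each nonzero entry of the shift; at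
  the wrap-around the \<open>n\<close>-th power is 1.\<close>

lemma adjoint_clock_shift_commute:
  assumes "n > 0"
  shows "mat_adjoint (clock_mat n) * mat_adjoint (shift_mat n) =
    cnj (root_of_unity n) \<cdot>\<^sub>m (mat_adjoint (shift_mat n) * mat_adjoint (clock_mat n))"
proof -
  let ?q = "cnj (root_of_unity n)"
  have "?q ^ ((j + 1) mod n) = ?q * ?q ^ j" if "j < n" for j
  proof -
    have "?q ^ n = 1" using root_of_unity_power[OF assms] by (simp flip: complex_cnj_power)
    then show ?thesis
      using that by (cases "j + 1 = n") (auto simp flip: power_Suc)
  qed
  moreover have "mat_adjoint (clock_mat n) * mat_adjoint (shift_mat n) =
    Matrix.mat n n (\<lambda>(i, j). ?q ^ i * mat_adjoint (shift_mat n) $$ (i, j))"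
    by (subst adjoint_clock_mat, rule mat_diag_mult_left) simp
  moreover have "mat_adjoint (shift_mat n) * mat_adjoint (clock_mat n) =
    Matrix.mat n n (\<lambda>(i, j). mat_adjoint (shift_mat n) $$ (i, j) * ?q ^ j)"
    by (subst adjoint_clock_mat, rule mat_diag_mult_right) simp
  ultimately show ?thesis
    by (intro eq_matI) (auto simp: adjoint_shift_mat)
qed

lemma adjoint_clock_neq_shift:
  assumes "n > 1"
  shows "mat_adjoint (clock_mat n) \<noteq> mat_adjoint (shift_mat n)"
proof
  assume "mat_adjoint (clock_mat n) = mat_adjoint (shift_mat n)"
  then have "mat_adjoint (clock_mat n) $$ (0, 0) = mat_adjoint (shift_mat n) $$ (0, 0)" by simp
  then show False using assms by (simp add: adjoint_clock_mat adjoint_shift_mat mat_diag_def)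
qed

lemma unitary_mat_left_cancel:
  assumes "unitary_mat n Z" "A \<in> carrier_mat n n" "B \<in> carrier_mat n n" "Z * A = Z * B"
  shows "A = B"
proof -
  have Z: "Z \<in> carrier_mat n n" "mat_adjoint Z \<in> carrier_mat n n" "mat_adjoint Z * Z = 1\<^sub>m n"
    using assms(1) by (auto simp: unitary_mat_def mat_adjoint_square)
  have "mat_adjoint Z * (Z * C) = C" if "C \<in> carrier_mat n n" for C
    using Z that by (simp flip: assoc_mult_mat)
  with assms show ?thesis by metis
qed

lemma unitary_mat_right_cancel:
  assumes "unitary_mat n Z" "A \<in> carrier_mat n n" "B \<in> carrier_mat n n" "A * Z = B * Z"
  shows "A = B"
proof -
  have Z: "Z \<in> carrier_mat n n" "mat_adjoint Z \<in> carrier_mat n n" "Z * mat_adjoint Z = 1\<^sub>m n"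
    using assms(1) by (auto simp: unitary_mat_def mat_adjoint_square)
  have "(C * Z) * mat_adjoint Z = C" if "C \<in> carrier_mat n n" for C
    using Z that by (simp add: assoc_mult_mat[of _ n n _ n _ n])
  with assms show ?thesis by metis
qed

text \<open>Carrying \<open>?U * ?V = ?q \<cdot>\<^sub>m (?V * ?U)\<close> through \<open>Z\<close>
  gives the same relation with \<open>?U\<close> and \<open>?V\<close> exchanged. Combining both
  yields \<open>?q * ?q = 1\<close>, which leaves only \<open>n = 2\<close>.\<close>

lemma clock_shift_swap_dim:
  assumes n: "n > 1" and Z: "unitary_mat n Z"
    and cs: "mat_adjoint (clock_mat n) * Z = Z * mat_adjoint (shift_mat n)"
    and sc: "mat_adjoint (shift_mat n) * Z = Z * mat_adjoint (clock_mat n)"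
  shows "n = 2"
proof -
  let ?U = "mat_adjoint (clock_mat n)" and ?V = "mat_adjoint (shift_mat n)"
  let ?q = "cnj (root_of_unity n)"
  have c: "Z \<in> carrier_mat n n" "?U \<in> carrier_mat n n" "?V \<in> carrier_mat n n"
    using Z by (auto simp: unitary_mat_def)
  note assoc = assoc_mult_mat[of _ n n _ n _ n]
  have comm: "?U * ?V = ?q \<cdot>\<^sub>m (?V * ?U)" using adjoint_clock_shift_commute n by simp
  have smult: "k \<cdot>\<^sub>m (l \<cdot>\<^sub>m A) = (k * l) \<cdot>\<^sub>m A" for k l :: complex and A
    by (rule eq_matI) auto
  have VU: "?V * ?U \<in> carrier_mat n n" using c by (intro mult_carrier_mat)
  have "Z * (?V * ?U) = (?U * Z) * ?U" using c by (simp add: cs assoc)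
  also have "\<dots> = ?U * (?V * Z)" using c by (simp add: sc assoc)
  also have "\<dots> = ?U * ?V * Z" using c by (simp add: assoc)
  also have "\<dots> = ?q \<cdot>\<^sub>m (?V * ?U * Z)" unfolding comm
    by (rule mult_smult_assoc_mat[OF VU c(1)])
  also have "?V * ?U * Z = ?V * Z * ?V" using c by (simp add: cs assoc)
  also have "\<dots> = Z * (?U * ?V)" unfolding sc using c by (simp add: assoc)
  also have "?q \<cdot>\<^sub>m \<dots> = Z * ((?q * ?q) \<cdot>\<^sub>m (?V * ?U))"
    unfolding comm using c by (simp add: mult_smult_distrib[OF c(1) VU] mult_smult_distrib[OF c(1) smult_carrier_mat[OF VU]] smult)
  finally have fixpoint: "?V * ?U = (?q * ?q) \<cdot>\<^sub>m (?V * ?U)"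
    by (rule unitary_mat_left_cancel[OF Z VU smult_carrier_mat[OF VU]])
  \<comment> \<open>A single nonzero entry suffices to extract the scalar from
    \<open>fixpoint\<close>; row 1 exists since \<open>n > 1\<close>.\<close>
  have entry: "(?V * ?U) $$ (1, 0) = 1"
  proof -
    have "?V * ?U = Matrix.mat n n (\<lambda>(i, j). ?V $$ (i, j) * ?q ^ j)"
      by (subst adjoint_clock_mat, rule mat_diag_mult_right) simp
    then show ?thesis using n by (simp add: adjoint_shift_mat)
  qed
  have "((?q * ?q) \<cdot>\<^sub>m (?V * ?U)) $$ (1, 0) = ?q * ?q * (?V * ?U) $$ (1, 0)"
    using n carrier_matD[OF c(2)] carrier_matD[OF c(3)] by (intro index_smult_mat) simp_all
  then have "?q * ?q = 1" unfolding fixpoint[symmetric] entry by simp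
  then have "cnj (root_of_unity n ^ 2) = 1" by (simp add: power2_eq_square)
  then have "root_of_unity n ^ 2 = 1" by (metis complex_cnj_cnj complex_cnj_one)
  then show ?thesis using root_of_unity_square_eq_1[of n] n by simp
qed

text \<open>The normalised Fourier matrix of order 2. For \<open>n = 2\<close> clock and shift are
  the Pauli matrices Z and X, which it exchanges by conjugation.\<close>

definition hadamard_mat :: "complex mat" where
  "hadamard_mat = Matrix.mat 2 2 (\<lambda>(i, j). (if i = 1 \<and> j = 1 then -1 else 1) / of_real (sqrt 2))"

lemma adjoint_hadamard_mat: "mat_adjoint hadamard_mat = hadamard_mat"
  by (subst mat_adjoint_square[where n = 2]) (auto simp: hadamard_mat_def intro!: eq_matI)

lemma hadamard_mat_square: "hadamard_mat * hadamard_mat = 1\<^sub>m 2"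
  by (rule eq_matI)
    (auto simp: hadamard_mat_def scalar_prod_def less_2_cases_iff atLeast0LessThan lessThan_Suc numeral_2_eq_2
      simp flip: of_real_mult)

lemma unitary_hadamard_mat: "unitary_mat 2 hadamard_mat"
  unfolding unitary_mat_def adjoint_hadamard_mat hadamard_mat_square
  by (simp add: hadamard_mat_def)

lemma hadamard_swap:
  "mat_adjoint (clock_mat 2) * hadamard_mat = hadamard_mat * mat_adjoint (shift_mat 2)"
  "mat_adjoint (shift_mat 2) * hadamard_mat = hadamard_mat * mat_adjoint (clock_mat 2)"
proof -
  have two: "{0..<2} = {0, 1::nat}" by auto
  have w: "root_of_unity 2 = -1" by (simp add: root_of_unity_def)
  show "mat_adjoint (clock_mat 2) * hadamard_mat = hadamard_mat * mat_adjoint (shift_mat 2)"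
    by (rule eq_matI) (auto simp: adjoint_clock_mat adjoint_shift_mat mat_diag_def hadamard_mat_def
      scalar_prod_def less_2_cases_iff two w)
  show "mat_adjoint (shift_mat 2) * hadamard_mat = hadamard_mat * mat_adjoint (clock_mat 2)"
    by (rule eq_matI) (auto simp: adjoint_clock_mat adjoint_shift_mat mat_diag_def hadamard_mat_def
      scalar_prod_def less_2_cases_iff two w)
qed

section \<open>Unitary equivalence\<close>

lemma mat_eqI_unit_vec:
  fixes A B :: "'a :: comm_semiring_1 mat"
  assumes A: "A \<in> carrier_mat n n" and B: "B \<in> carrier_mat n n"
    and eq: "\<And>j. j < n \<Longrightarrow> A *\<^sub>v unit_vec n j = B *\<^sub>v unit_vec n j"
  shows "A = B"
proof (rule eq_matI)
  fix i j assume "i < dim_row B" "j < dim_col B"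
  then have ij: "i < n" "j < n" using B by auto
  have "(C *\<^sub>v unit_vec n j) $ i = C $$ (i, j)" if "C \<in> carrier_mat n n" for C :: "'a mat"
    using that ij by simp
  then show "A $$ (i, j) = B $$ (i, j)" using eq[OF ij(2)] A B by metis
qed (use A B in auto)

lemma left_shift_eq: "left_shift x = inv_into UNIV right_shift x"
  by (simp add: left_shift_def inv_right_shift)

text \<open>The common form of \<open>W\<close> and \<open>W'\<close>, whose value at
  \<open>x\<close> depends only on the letter \<open>x 0\<close>.\<close>

definition letter_mat :: "nat \<Rightarrow> 'a set \<Rightarrow> 'a \<Rightarrow> complex mat" where
  "letter_mat n S l = (if l \<in> S then mat_adjoint (clock_mat n) else mat_adjoint (shift_mat n))"

lemma letter_mat_carrier [simp]: "letter_mat n S l \<in> carrier_mat n n"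
  by (simp add: letter_mat_def)

lemma monomial_unitary_letter_mat: "monomial_unitary n (letter_mat n S l)"
  by (simp add: letter_mat_def monomial_unitary_adjoint_clock monomial_unitary_adjoint_shift)

lemma W_fun_cylinder0:
  assumes "\<forall>i. x i \<in> \<Lambda>"
  shows "W_fun n (cylinder0 \<Lambda> S) ({x. \<forall>i. x i \<in> \<Lambda>} - cylinder0 \<Lambda> S) x = letter_mat n S (x 0)"
  using assms by (auto simp: W_fun_def letter_mat_def cylinder0_def adjoint_clock_mat adjoint_shift_mat
    mat_diag_def intro!: eq_matI)

text \<open>As \<open>C1 \<noteq> C1'\<close>, some letter lies in exactly one of them, and there
  \<open>Z\<close> turns one generator into the other. The generators differ, so \<open>Z\<close>
  commutes with neither, which excludes letters in both sets or in none. Both sets being nonempty,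
  both exchange relations then hold.\<close>

lemma intertwined_letter_mats:
  assumes n: "n > 1" and Z: "unitary_mat n Z"
    and C1: "C1 \<noteq> {}" "C1 \<subset> \<Lambda>" and C1': "C1' \<noteq> {}" "C1' \<subset> \<Lambda>" and neq: "C1 \<noteq> C1'"
    and inter: "\<And>l. l \<in> \<Lambda> \<Longrightarrow> letter_mat n C1 l * Z = Z * letter_mat n C1' l"
  shows "n = 2" and "C1' = \<Lambda> - C1"
proof -
  let ?U = "mat_adjoint (clock_mat n)" and ?V = "mat_adjoint (shift_mat n)"
  have "?U \<noteq> ?V" by (rule adjoint_clock_neq_shift[OF n])
  then have UV: "Z * ?U \<noteq> Z * ?V" "?U * Z \<noteq> ?V * Z"
    using unitary_mat_left_cancel[OF Z, of ?U ?V] unitary_mat_right_cancel[OF Z, of ?U ?V] by auto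
  have in_both: "?U * Z = Z * ?U" if "l \<in> C1" "l \<in> C1'" for l
    using inter[of l] that C1 by (auto simp: letter_mat_def)
  have in_neither: "?V * Z = Z * ?V" if "l \<in> \<Lambda>" "l \<notin> C1" "l \<notin> C1'" for l
    using inter[of l] that by (simp add: letter_mat_def)
  have in_first: "?U * Z = Z * ?V" if "l \<in> C1" "l \<notin> C1'" for l
    using inter[of l] that C1 by (auto simp: letter_mat_def)
  have in_second: "?V * Z = Z * ?U" if "l \<notin> C1" "l \<in> C1'" for l
    using inter[of l] that C1' by (auto simp: letter_mat_def)
  have "?U * Z = Z * ?V \<or> ?V * Z = Z * ?U"
    using neq in_first in_second by blast
  then have not: "?U * Z \<noteq> Z * ?U" "?V * Z \<noteq> Z * ?V"
    using UV by auto
  show compl: "C1' = \<Lambda> - C1"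
    using not in_both in_neither C1' by blast
  obtain l l' where "l \<in> C1" "l' \<in> C1'" using C1 C1' by blast
  with compl have "?U * Z = Z * ?V" "?V * Z = Z * ?U"
    using in_first[of l] in_second[of l'] by auto
  then show "n = 2" by (rule clock_shift_swap_dim[OF n Z])
qed

context prob_space
begin

text \<open>The event \<open>x 0 = l\<close> has positive measure, so it cannot lie in the
  exceptional null set.\<close>

lemma AE_letterD:
  assumes "AE x in bernoulli_measure M. R (x 0)" and l: "{l} \<in> sets M" "measure M {l} > 0"
  shows "R l"
proof (rule ccontr)
  assume "\<not> R l"
  interpret PB: product_prob_space "\<lambda>_. M" "UNIV :: int set" by unfold_locales
  have "AE x in bernoulli_measure M. x 0 \<noteq> l"
    using assms(1) by eventually_elim (use \<open>\<not> R l\<close> in auto)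
  then have "AE x in (\<Pi>\<^sub>M i\<in>(UNIV :: int set). M). x 0 \<notin> {l}"
    unfolding bernoulli_measure_def by simp
  moreover have "{x \<in> space (\<Pi>\<^sub>M i\<in>(UNIV :: int set). M). x 0 \<in> {l}} \<in> sets (\<Pi>\<^sub>M i\<in>(UNIV :: int set). M)"
    using l(1) by measurable
  ultimately have "emeasure (\<Pi>\<^sub>M i\<in>(UNIV :: int set). M) {x \<in> space (\<Pi>\<^sub>M i\<in>(UNIV :: int set). M). x 0 \<in> {l}} = 0"
    by (subst (asm) AE_iff_measurable[OF _ refl]) auto
  then have "emeasure M {l} = 0"
    using PB.emeasure_PiM_Collect_single[of 0 "{l}"] l(1) by simp
  with l(2) show False by (simp add: measure_def)
qed

lemma AE_left_shift:
  assumes "AE x in bernoulli_measure M. P x"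
  shows "AE x in bernoulli_measure M. P (left_shift x)"
  by (rule AE_distrD[OF measurable_left_shift]) (simp only: distr_left_shift assms)

text \<open>The operator identity is tested on the constant functions \<open>unit_vec n j\<close>,
  which are square-integrable for a probability measure and fixed by \<open>V_op\<close>. This
  yields the matrix identity column by column, and unitarity at the shifted point moves the adjoint
  to the other side.\<close>

lemma unitarily_equivalent_cocycle:
  assumes W: "\<And>x. x \<in> space (bernoulli_measure M) \<Longrightarrow> W x \<in> carrier_mat n n"
    and W': "\<And>x. x \<in> space (bernoulli_measure M) \<Longrightarrow> W' x \<in> carrier_mat n n"
    and eq: "unitarily_equivalent (bernoulli_measure M) n (mult_op W \<circ> V_op) (mult_op W' \<circ> V_op)"
  obtains \<zeta> where "\<zeta> \<in> Linf_unitary (bernoulli_measure M) n"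
    and "AE x in bernoulli_measure M. W x * \<zeta> (left_shift x) = \<zeta> x * W' x"
proof -
  interpret B: prob_space "bernoulli_measure M" by (rule prob_space_bernoulli)
  let ?B = "bernoulli_measure M"
  from eq obtain \<zeta> where \<zeta>: "\<zeta> \<in> Linf_unitary ?B n"
    and op: "op_eq ?B n (mult_op W \<circ> V_op) (mult_op \<zeta> \<circ> (mult_op W' \<circ> V_op) \<circ> mult_op (\<lambda>x. mat_adjoint (\<zeta> x)))"
    unfolding unitarily_equivalent_def by blast
  have unit: "AE x in ?B. unitary_mat n (\<zeta> x)"
    using \<zeta> by (simp add: Linf_unitary_def)
  have "(\<lambda>_. unit_vec n j) \<in> L2_vec ?B n" if "j < n" for j
    using that by (auto simp: L2_vec_def)
  then have "AE x in ?B. W x *\<^sub>v unit_vec n j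
      = \<zeta> x *\<^sub>v (W' x *\<^sub>v (mat_adjoint (\<zeta> (left_shift x)) *\<^sub>v unit_vec n j))" if "j \<in> {..<n}" for j
    using op that unfolding op_eq_def by (fastforce simp: mult_op_def V_op_def left_shift_eq)
  then have "AE x in ?B. \<forall>j\<in>{..<n}. W x *\<^sub>v unit_vec n j
      = \<zeta> x *\<^sub>v (W' x *\<^sub>v (mat_adjoint (\<zeta> (left_shift x)) *\<^sub>v unit_vec n j))"
    by (intro AE_finite_allI) auto
  with unit AE_left_shift[OF unit] AE_space
  have "AE x in ?B. W x * \<zeta> (left_shift x) = \<zeta> x * W' x"
  proof eventually_elim
    case (elim x)
    let ?Z = "\<zeta> (left_shift x)"
    have c: "W x \<in> carrier_mat n n" "W' x \<in> carrier_mat n n" "\<zeta> x \<in> carrier_mat n n"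
      "?Z \<in> carrier_mat n n" "mat_adjoint ?Z \<in> carrier_mat n n" "mat_adjoint ?Z * ?Z = 1\<^sub>m n"
      using elim W W' by (auto simp: unitary_mat_def mat_adjoint_square)
    have "W x = \<zeta> x * (W' x * mat_adjoint ?Z)"
      by (rule mat_eqI_unit_vec) (use c elim(4) in \<open>auto simp: assoc_mult_mat_vec[of _ n n _ n]\<close>)
    then have "W x * ?Z = \<zeta> x * (W' x * (mat_adjoint ?Z * ?Z))"
      using c by (simp add: assoc_mult_mat[of _ n n _ n _ n] del: c(6))
    with c show ?case by simp
  qed
  with \<zeta> show thesis by (rule that)
qed

text \<open>The transfer lemma applies to the entries of \<zeta>, with isometry supplied by
  \<open>entry_norm\<close>. Thus \<zeta> is almost everywhere constant, and the cocycle relation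
  can be read off letter by letter.\<close>

lemma constant_intertwiner:
  assumes W: "\<And>x. x \<in> space (bernoulli_measure M) \<Longrightarrow> W x = letter_mat n S (x 0)"
    and W': "\<And>x. x \<in> space (bernoulli_measure M) \<Longrightarrow> W' x = letter_mat n S' (x 0)"
    and eq: "unitarily_equivalent (bernoulli_measure M) n (mult_op W \<circ> V_op) (mult_op W' \<circ> V_op)"
    and letters: "\<And>l. l \<in> \<Lambda> \<Longrightarrow> {l} \<in> sets M" "\<And>l. l \<in> \<Lambda> \<Longrightarrow> measure M {l} > 0"
  obtains Z where "unitary_mat n Z" and "\<And>l. l \<in> \<Lambda> \<Longrightarrow> letter_mat n S l * Z = Z * letter_mat n S' l"
proof -
  interpret B: prob_space "bernoulli_measure M" by (rule prob_space_bernoulli)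
  let ?B = "bernoulli_measure M" and ?P = "{..<n} \<times> {..<n}"
  obtain \<zeta> where \<zeta>: "\<zeta> \<in> Linf_unitary ?B n"
    and "AE x in ?B. W x * \<zeta> (left_shift x) = \<zeta> x * W' x"
    by (rule unitarily_equivalent_cocycle[OF _ _ eq]) (simp_all add: W W')
  from this(2) AE_space
  have cocycle: "AE x in ?B. letter_mat n S (x 0) * \<zeta> (left_shift x) = \<zeta> x * letter_mat n S' (x 0)"
    by eventually_elim (simp add: W W')
  have unit: "AE x in ?B. unitary_mat n (\<zeta> x)"
    using \<zeta> by (simp add: Linf_unitary_def)
  define Q where "Q x \<longleftrightarrow> \<zeta> x \<in> carrier_mat n n \<and> \<zeta> (left_shift x) \<in> carrier_mat n n \<and>
    letter_mat n S (x 0) * \<zeta> (left_shift x) = \<zeta> x * letter_mat n S' (x 0)" for x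
  have Q: "AE x in ?B. Q x"
    using cocycle unit AE_left_shift[OF unit] unfolding Q_def
    by eventually_elim (simp add: unitary_mat_def)
  have const: "AE x in ?B. AE y in ?B. \<forall>p\<in>?P. \<zeta> x $$ p = \<zeta> y $$ p"
  proof (rule isometric_cocycle_transfer_constant[OF _ _ Q, where f = "\<lambda>p x. \<zeta> x $$ p"])
    fix p assume "p \<in> ?P"
    then have meas: "(\<lambda>x. \<zeta> x $$ p) \<in> borel_measurable ?B" and bd: "\<exists>B. AE x in ?B. norm (\<zeta> x $$ p) \<le> B"
      using \<zeta> by (auto simp: Linf_unitary_def Linf_mat_def)
    from bd obtain B where "AE x in ?B. norm (\<zeta> x $$ p) \<le> B" by blast
    then show "integrable ?B (\<lambda>x. \<zeta> x $$ p)"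
      using meas by (rule B.integrable_const_bound)
  next
    fix x y :: "int \<Rightarrow> 'a" assume "Q x" "Q y" and 0: "x 0 = y 0"
    let ?Tx = "left_shift x" and ?Ty = "left_shift y" and ?A = "letter_mat n S (x 0)" and ?A' = "letter_mat n S' (x 0)"
    have c: "\<zeta> x \<in> carrier_mat n n" "\<zeta> ?Tx \<in> carrier_mat n n" "\<zeta> y \<in> carrier_mat n n" "\<zeta> ?Ty \<in> carrier_mat n n"
      and e: "?A * \<zeta> ?Tx = \<zeta> x * ?A'" "?A * \<zeta> ?Ty = \<zeta> y * ?A'"
      using \<open>Q x\<close> \<open>Q y\<close> 0 by (simp_all add: Q_def)
    have sum: "(\<Sum>p\<in>?P. norm (X $$ p - Y $$ p)) = entry_norm n (X - Y)"
      if "X \<in> carrier_mat n n" "Y \<in> carrier_mat n n" for X Y :: "complex mat"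
      unfolding entry_norm_def using that by (intro sum.cong) auto
    \<comment> \<open>Since \<open>x 0 = y 0\<close>, the same two monomial matrices occur in both
      relations, which can therefore be subtracted.\<close>
    have "entry_norm n (\<zeta> ?Tx - \<zeta> ?Ty) = entry_norm n (?A * (\<zeta> ?Tx - \<zeta> ?Ty))"
      using c by (intro entry_norm_monomial_mult[symmetric] monomial_unitary_letter_mat minus_carrier_mat)
    also have "?A * (\<zeta> ?Tx - \<zeta> ?Ty) = (\<zeta> x - \<zeta> y) * ?A'"
      using c by (simp add: mult_minus_distrib_mat[of _ n n _ n] minus_mult_distrib_mat[of _ n n _ _ n] e)
    also have "entry_norm n \<dots> = entry_norm n (\<zeta> x - \<zeta> y)"
      using c by (intro entry_norm_mult_monomial monomial_unitary_letter_mat minus_carrier_mat)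
    finally show "(\<Sum>p\<in>?P. norm (\<zeta> ?Tx $$ p - \<zeta> ?Ty $$ p)) = (\<Sum>p\<in>?P. norm (\<zeta> x $$ p - \<zeta> y $$ p))"
      using c by (simp add: sum)
  qed simp
  from const unit have "AE x in ?B. unitary_mat n (\<zeta> x) \<and> (AE y in ?B. \<forall>p\<in>?P. \<zeta> x $$ p = \<zeta> y $$ p)"
    by eventually_elim simp
  \<comment> \<open>A property holding almost everywhere for a probability measure holds at some
    point; the value of \<zeta> there serves as the constant.\<close>
  then obtain x0 where Z: "unitary_mat n (\<zeta> x0)" and x0: "AE y in ?B. \<forall>p\<in>?P. \<zeta> x0 $$ p = \<zeta> y $$ p"
    using eventually_happens'[OF B.ae_filter_bot] by blast
  from x0 unit have Zy: "AE y in ?B. \<zeta> y = \<zeta> x0"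
  proof eventually_elim
    case (elim y)
    then show ?case using Z by (intro eq_matI) (auto simp: unitary_mat_def)
  qed
  have "AE y in ?B. letter_mat n S (y 0) * \<zeta> x0 = \<zeta> x0 * letter_mat n S' (y 0)"
    using Zy AE_left_shift[OF Zy] cocycle by eventually_elim simp
  then have "letter_mat n S l * \<zeta> x0 = \<zeta> x0 * letter_mat n S' l" if "l \<in> \<Lambda>" for l
    using AE_letterD[of "\<lambda>l. letter_mat n S l * \<zeta> x0 = \<zeta> x0 * letter_mat n S' l"] letters[OF that] by blast
  with Z show thesis by (rule that)
qed

text \<open>The constant function \<open>hadamard_mat\<close> implements the equivalence: it
  commutes with \<open>V_op\<close>, is its own adjoint and inverse, and exchanges the two letter
  matrices.\<close>

lemma swapped_letters_unitarily_equivalent: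
  assumes W: "\<And>x. x \<in> space (bernoulli_measure M) \<Longrightarrow> W x = letter_mat 2 S (x 0)"
    and W': "\<And>x. x \<in> space (bernoulli_measure M) \<Longrightarrow> W' x = letter_mat 2 (- S) (x 0)"
  shows "unitarily_equivalent (bernoulli_measure M) 2 (mult_op W \<circ> V_op) (mult_op W' \<circ> V_op)"
proof -
  let ?H = hadamard_mat
  have c: "?H \<in> carrier_mat 2 2" by (simp add: hadamard_mat_def)
  have "(\<lambda>_. ?H) \<in> Linf_unitary (bernoulli_measure M) 2"
    using c unitary_hadamard_mat by (auto simp: Linf_unitary_def Linf_mat_def)
  moreover have "op_eq (bernoulli_measure M) 2 (mult_op W \<circ> V_op)
    (mult_op (\<lambda>_. ?H) \<circ> (mult_op W' \<circ> V_op) \<circ> mult_op (\<lambda>_. mat_adjoint ?H))"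
    unfolding op_eq_def
  proof (intro ballI AE_I2)
    fix \<xi> x assume \<xi>: "\<xi> \<in> L2_vec (bernoulli_measure M) 2" and x: "x \<in> space (bernoulli_measure M)"
    have v: "\<xi> (left_shift x) \<in> carrier_vec 2"
      using \<xi> measurable_space[OF measurable_left_shift x] by (simp add: L2_vec_def)
    have "?H * letter_mat 2 (- S) (x 0) = letter_mat 2 S (x 0) * ?H"
      by (simp add: letter_mat_def hadamard_swap)
    then have LH: "?H * letter_mat 2 (- S) (x 0) * ?H = letter_mat 2 S (x 0)"
      using c by (simp add: assoc_mult_mat[of _ 2 2 _ 2 _ 2] hadamard_mat_square right_mult_one_mat[OF letter_mat_carrier])
    have "(?H * letter_mat 2 (- S) (x 0) * ?H) *\<^sub>v v = ?H *\<^sub>v (letter_mat 2 (- S) (x 0) *\<^sub>v (?H *\<^sub>v v))"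
      if "v \<in> carrier_vec 2" for v
      using c that by (simp add: assoc_mult_mat_vec[of _ 2 2 _ 2])
    from this[unfolded LH]
    have "letter_mat 2 S (x 0) *\<^sub>v v = ?H *\<^sub>v (letter_mat 2 (- S) (x 0) *\<^sub>v (?H *\<^sub>v v))"
      if "v \<in> carrier_vec 2" for v
      using that .
    with v show "(mult_op W \<circ> V_op) \<xi> x =
      (mult_op (\<lambda>_. ?H) \<circ> (mult_op W' \<circ> V_op) \<circ> mult_op (\<lambda>_. mat_adjoint ?H)) \<xi> x"
      by (simp add: mult_op_def V_op_def left_shift_eq adjoint_hadamard_mat W[OF x] W'[OF x])
  qed
  ultimately show ?thesis
    unfolding unitarily_equivalent_def by blast
qed

end

theorem proposition4p7:
  fixes \<Lambda> C1 C1' :: "'a set" and \<mu>1 :: "'a measure" and n :: nat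
    and X C C' D D' :: "(int \<Rightarrow> 'a) set" and \<mu> :: "(int \<Rightarrow> 'a) measure"
    and W W' :: "(int \<Rightarrow> 'a) \<Rightarrow> complex mat"
  assumes "finite \<Lambda>" and "card \<Lambda> > 1"
    and "prob_space \<mu>1" and "space \<mu>1 = \<Lambda>" and "sets \<mu>1 = Pow \<Lambda>"
    and "\<And>l. l \<in> \<Lambda> \<Longrightarrow> measure \<mu>1 {l} > 0"
    and "n > 1"
    and "C1 \<noteq> {}" and "C1 \<subset> \<Lambda>" and "C1' \<noteq> {}" and "C1' \<subset> \<Lambda>"
  defines "\<mu> \<equiv> bernoulli_measure \<mu>1"
    and "X \<equiv> {x. \<forall>i. x i \<in> \<Lambda>}"
    and "C \<equiv> cylinder0 \<Lambda> C1" and "C' \<equiv> cylinder0 \<Lambda> C1'"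
    and "D \<equiv> X - C" and "D' \<equiv> X - C'"
    and "W \<equiv> W_fun n C D" and "W' \<equiv> W_fun n C' D'"
  assumes "C \<noteq> C'"
  shows "unitarily_equivalent \<mu> n (mult_op W \<circ> V_op) (mult_op W' \<circ> V_op)
    \<longleftrightarrow> n = 2 \<and> C = D' \<and> D = C'"
proof -
  interpret prob_space \<mu>1 by fact
  have space: "x \<in> space (bernoulli_measure \<mu>1) \<longleftrightarrow> (\<forall>i. x i \<in> \<Lambda>)" for x
    by (auto simp: bernoulli_measure_def space_PiM PiE_iff \<open>space \<mu>1 = \<Lambda>\<close>)
  have W: "W x = letter_mat n C1 (x 0)" if "x \<in> space (bernoulli_measure \<mu>1)" for x
    unfolding W_def D_def X_def C_def using that by (intro W_fun_cylinder0) (simp add: space)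
  have W': "W' x = letter_mat n C1' (x 0)" if "x \<in> space (bernoulli_measure \<mu>1)" for x
    unfolding W'_def D'_def X_def C'_def using that by (intro W_fun_cylinder0) (simp add: space)
  have compl: "C = D' \<and> D = C'" if "C1' = \<Lambda> - C1"
    using that by (auto simp: C_def C'_def D_def D'_def X_def cylinder0_def)
  have compl': "C1' = \<Lambda> - C1" if "C = D'"
  proof -
    have "l \<in> C1' \<longleftrightarrow> l \<notin> C1" if "l \<in> \<Lambda>" for l
    proof -
      \<comment> \<open>Constant sequences recover the letter sets from the cylinders.\<close>
      have "(\<lambda>_. l) \<in> C \<longleftrightarrow> (\<lambda>_. l) \<in> D'" using \<open>C = D'\<close> by simp
      then show ?thesis using that by (auto simp: C_def D'_def X_def C'_def cylinder0_def)
    qed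
    then show ?thesis using \<open>C1' \<subset> \<Lambda>\<close> by blast
  qed
  show ?thesis
  proof
    assume eq: "unitarily_equivalent \<mu> n (mult_op W \<circ> V_op) (mult_op W' \<circ> V_op)"
    have "C1 \<noteq> C1'" using \<open>C \<noteq> C'\<close> by (auto simp: C_def C'_def)
    obtain Z where Z: "unitary_mat n Z"
      and "\<And>l. l \<in> \<Lambda> \<Longrightarrow> letter_mat n C1 l * Z = Z * letter_mat n C1' l"
      using constant_intertwiner[OF W W' eq[unfolded \<mu>_def], of \<Lambda>] assms(5,6) by auto
    from intertwined_letter_mats[OF \<open>n > 1\<close> Z \<open>C1 \<noteq> {}\<close> \<open>C1 \<subset> \<Lambda>\<close> \<open>C1' \<noteq> {}\<close> \<open>C1' \<subset> \<Lambda>\<close> \<open>C1 \<noteq> C1'\<close> this(2)]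
    show "n = 2 \<and> C = D' \<and> D = C'" using compl by blast
  next
    assume R: "n = 2 \<and> C = D' \<and> D = C'"
    then have "C1' = \<Lambda> - C1" using compl' by blast
    \<comment> \<open>All letters of a point of the space lie in \<Lambda>, so the complements of
      \<open>C1\<close> in \<Lambda> and in the whole type give the same matrix.\<close>
    then have "W' x = letter_mat 2 (- C1) (x 0)" if "x \<in> space (bernoulli_measure \<mu>1)" for x
      using W'[OF that] that R by (simp add: letter_mat_def space)
    moreover have "W x = letter_mat 2 C1 (x 0)" if "x \<in> space (bernoulli_measure \<mu>1)" for x
      using W[OF that] R by simp
    ultimately have "unitarily_equivalent (bernoulli_measure \<mu>1) 2 (mult_op W \<circ> V_op) (mult_op W' \<circ> V_op)"
      by (intro swapped_letters_unitarily_equivalent)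
    then show "unitarily_equivalent \<mu> n (mult_op W \<circ> V_op) (mult_op W' \<circ> V_op)"
      unfolding \<mu>_def using R by simp
  qed
qed

end
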